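(* Let $n_0,n_1$ be nonnegative integers, let $n=n_0+n_1\geq 1$, and suppose that $n_1=2$ or $n_1=n-1$. Then for all nonnegative integers $a,b,k$, $$\operatorname{CT}_x\prod_{n_0+1\le i\ne j\le n}\left(1-\frac{x_i}{x_j}\right)\cdot\prod_{l=1}^n\left(1-\frac{x_l}{x_0}\right)^{a}\left(1-\frac{x_0}{x_l}\right)^{b}\prod_{1\le i\ne j\le n}\left(1-\frac{x_i}{x_j}\right)^{k}$$ $$=M_{n_0}(a,b,k)\prod_{j=0}^{n_1-1}\frac{(j+1)\,((k+1)j+a+b+kn_0)!\,(kj+k+j+kn_0)!}{k!\,((k+1)j+a+kn_0)!\,((k+1)j+b+kn_0)!}.$$
   Context: $\operatorname{CT}_x$ denotes the constant term (the coefficient of $x_0^0x_1^0\cdots x_n^0$) of a Laurent polynomial in $x_0,\ldots,x_n$. Products over $i\neq j$ are over ordered pairs. For $n_0\ge 0$, $$M_{n_0}(a,b,k):=\prod_{l=0}^{n_0-1}\frac{(a+b+kl)!\,(k(l+1))!}{(a+kl)!\,(b+kl)!\,k!},$$ with the empty product equal to $1$. *)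

theory Defs
  imports Complex_Main "HOL-Library.Poly_Mapping"
begin

text \<open>
  Laurent polynomials in indeterminates \<open>x\<^sub>0, x\<^sub>1, \<dots>\<close> over the rationals: the group algebra of the
  finitely supported exponent vectors \<open>nat \<Rightarrow>\<^sub>0 int\<close>. The ring operations are the convolution
  operations on \<^typ>\<open>'a \<Rightarrow>\<^sub>0 'b\<close>. There are infinitely many indeterminates, so that the number of
  variables may vary; each element involves only finitely many of them.
  Below, \<open>X_powi i e\<close> is \<open>x\<^sub>i\<close> to the power \<open>e\<close>, and \<open>X_ratio i j\<close> is \<open>x\<^sub>i / x\<^sub>j\<close>.
\<close>

type_synonym laurent = "(nat \<Rightarrow>\<^sub>0 int) \<Rightarrow>\<^sub>0 rat"

definition X_powi :: "nat \<Rightarrow> int \<Rightarrow> laurent"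
  where "X_powi i e = Poly_Mapping.single (Poly_Mapping.single i e) 1"

definition X_ratio :: "nat \<Rightarrow> nat \<Rightarrow> laurent"
  where "X_ratio i j = X_powi i 1 * X_powi j (-1)"

definition CT :: "laurent \<Rightarrow> rat"
  where "CT p = Poly_Mapping.lookup p 0"

definition off_diag :: "nat set \<Rightarrow> (nat \<times> nat) set"
  where "off_diag S = {(i, j). i \<in> S \<and> j \<in> S \<and> i \<noteq> j}"

definition M :: "nat \<Rightarrow> nat \<Rightarrow> nat \<Rightarrow> nat \<Rightarrow> rat"
  where "M n0 a b k =
    (\<Prod>l<n0. (fact (a + b + k * l) * fact (k * (l + 1))) /
              (fact (a + k * l) * fact (b + k * l) * fact k))"

lemma X_powi_add: "X_powi i d * X_powi i e = X_powi i (d + e)"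
  by (simp add: X_powi_def mult_single single_add)

lemma X_powi_0: "X_powi i 0 = 1"
  by (simp add: X_powi_def)

lemma X_powi_inverse: "X_powi i 1 * X_powi i (-1) = 1"
  by (simp add: X_powi_add X_powi_0)

end

theory Submission
  imports Defs "HOL-Library.FuncSet" "HOL-Library.Multiset" "HOL-Computational_Algebra.Polynomial"
begin

text \<open>
  Write \<open>\<kappa>\<^sub>i\<^sub>j\<close> for the exponent of \<open>1 - x\<^sub>i/x\<^sub>j\<close>, that is \<open>k + 1\<close> inside the last block of variables and
  \<open>k\<close> elsewhere, and \<open>K\<^sub>l\<close> for the sum of the \<open>\<kappa>\<^sub>i\<^sub>l\<close> over \<open>i\<close>. With \<open>b\<close> fixed, the constant term is a
  polynomial in \<open>a\<close>; the proof bounds its degree and finds as many roots, with multiplicities.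

  The product of all \<open>(z\<^sub>j - z\<^sub>i)^\<kappa>\<^sub>i\<^sub>j\<close> is a combination of monomials \<open>z^\<alpha>\<close> whose coefficients do
  not depend on what \<open>z\<close> is. Substituting \<open>z\<^sub>l = x\<^sub>l\<close> turns the constant term into a combination of
  products over \<open>l\<close> of binomials \<open>a + b\<close> choose \<open>K\<^sub>l + b - \<alpha>\<^sub>l\<close>, so its degree in \<open>a\<close> is at most
  \<open>n b\<close>. The product only involves differences, so \<open>z\<^sub>l = x\<^sub>l - x\<^sub>0\<close> is equally possible, and gives
  products of binomials \<open>a + b + \<alpha>\<^sub>l\<close> choose \<open>K\<^sub>l + b\<close>, whose roots in \<open>a\<close> are visible. Which
  exponents \<open>\<alpha>\<close> occur is restricted by one fact: the part of \<open>\<alpha>\<close> inside a set \<open>J\<close> of variables is at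
  least the number of factors with both variables in \<open>J\<close>. Counting the variables with small and with
  large \<open>\<alpha>\<^sub>l\<close> then shows that every one of these products is divisible by the product of all
  \<open>a + P\<^sub>l + s\<close> with \<open>l < n\<close> and \<open>1 \<le> s \<le> b\<close>, where \<open>P\<^sub>l = k l + max(0, l - n\<^sub>0)\<close>. This has degree \<open>n b\<close>,
  so the constant term is a multiple of it, which is \<open>CT_morris_product\<close>. The count is where the
  restriction on \<open>n\<^sub>0\<close> and \<open>n\<^sub>1\<close> enters: it is carried out for \<open>n\<^sub>0 \<le> 1\<close> or \<open>n\<^sub>1 \<le> 2\<close>
  (\<open>root_profile_forrester\<close>).

  There remains the value at \<open>a = b = 0\<close>, where \<open>x\<^sub>0\<close> is absent. Then any variable outside the last block
  can take over the role of \<open>x\<^sub>0\<close>: the product is the one for the remaining variables with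
  \<open>a = b = k\<close>, so the result just described gives a recursion in the number of variables
  (\<open>ratio_constant_insert\<close>). It ends when only the last block is left, and a single block with exponent
  \<open>k + 1\<close> is computed by the same recursion.
\<close>

section \<open>Expanding products of differences\<close>

abbreviation X :: "nat \<Rightarrow> laurent" where "X i \<equiv> X_powi i 1"

text \<open>
  The map \<open>F\<close> is one homogeneous integer polynomial in the \<open>z\<^sub>i\<close>, with coefficients that serve all
  substitutions \<open>z\<close> at once. The weight \<open>w\<close> bounds from below how much of each monomial falls into a
  given set of variables; on all of \<open>I\<close> it is the degree.
\<close>

definition expands :: "nat set \<Rightarrow> ((nat \<Rightarrow> laurent) \<Rightarrow> laurent) \<Rightarrow> (nat set \<Rightarrow> nat) \<Rightarrow> bool"
  where "expands I F w \<longleftrightarrow> (\<exists>L :: (int \<times> (nat \<Rightarrow> nat)) list.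
    (\<forall>z. F z = (\<Sum>(r, \<alpha>)\<leftarrow>L. of_int r * (\<Prod>i\<in>I. z i ^ \<alpha> i))) \<and>
    (\<forall>(r, \<alpha>)\<in>set L. (\<Sum>i\<in>I. \<alpha> i) = w I \<and> (\<forall>J\<subseteq>I. w J \<le> (\<Sum>i\<in>J. \<alpha> i))))"

lemma expands_one: "expands I (\<lambda>_. 1) (\<lambda>_. 0)"
  unfolding expands_def by (rule exI[of _ "[(1, \<lambda>_. 0)]"]) simp

lemma prod_power_fun_upd_Suc:
  fixes z :: "nat \<Rightarrow> laurent"
  assumes "finite I" and "i \<in> I"
  shows "(\<Prod>l\<in>I. z l ^ (\<alpha>(i := Suc (\<alpha> i))) l) = z i * (\<Prod>l\<in>I. z l ^ \<alpha> l)"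
proof -
  have "(\<Prod>l\<in>I - {i}. z l ^ (\<alpha>(i := Suc (\<alpha> i))) l) = (\<Prod>l\<in>I - {i}. z l ^ \<alpha> l)"
    by (rule prod.cong) auto
  then show ?thesis
    by (simp add: prod.remove[OF assms] mult.assoc)
qed

lemma sum_fun_upd_Suc:
  fixes \<alpha> :: "nat \<Rightarrow> nat"
  assumes "finite J"
  shows "(\<Sum>l\<in>J. (\<alpha>(i := Suc (\<alpha> i))) l) = (\<Sum>l\<in>J. \<alpha> l) + of_bool (i \<in> J)"
proof (cases "i \<in> J")
  case True
  have "(\<Sum>l\<in>J - {i}. (\<alpha>(i := Suc (\<alpha> i))) l) = (\<Sum>l\<in>J - {i}. \<alpha> l)"
    by (rule sum.cong) auto
  then show ?thesis
    using True by (simp add: sum.remove[OF assms True])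
next
  case False
  then have "(\<Sum>l\<in>J. (\<alpha>(i := Suc (\<alpha> i))) l) = (\<Sum>l\<in>J. \<alpha> l)"
    by (intro sum.cong) auto
  then show ?thesis
    using False by simp
qed

text \<open>
  A factor \<open>z\<^sub>j - z\<^sub>i\<close> raises the exponent of either \<open>z\<^sub>j\<close> or \<open>z\<^sub>i\<close>. If both lie in \<open>J\<close>, the part of the
  monomial inside \<open>J\<close> grows by one whichever of the two is picked.
\<close>

lemma expands_times_difference:
  assumes I: "finite I" "i \<in> I" "j \<in> I" and F: "expands I F w"
  shows "expands I (\<lambda>z. (z j - z i) * F z) (\<lambda>J. w J + of_bool (i \<in> J \<and> j \<in> J))"
proof -
  define inc :: "nat \<Rightarrow> (nat \<Rightarrow> nat) \<Rightarrow> nat \<Rightarrow> nat" where "inc i \<alpha> = \<alpha>(i := Suc (\<alpha> i))" for i \<alpha>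
  obtain L where L: "\<And>z. F z = (\<Sum>(r, \<alpha>)\<leftarrow>L. of_int r * (\<Prod>l\<in>I. z l ^ \<alpha> l))"
    and w: "\<And>r \<alpha>. (r, \<alpha>) \<in> set L \<Longrightarrow> (\<Sum>i\<in>I. \<alpha> i) = w I"
    and wJ: "\<And>r \<alpha> J. (r, \<alpha>) \<in> set L \<Longrightarrow> J \<subseteq> I \<Longrightarrow> w J \<le> (\<Sum>i\<in>J. \<alpha> i)"
    using F unfolding expands_def by fastforce
  have mono: "(\<Prod>l\<in>I. z l ^ inc v \<alpha> l) = z v * (\<Prod>l\<in>I. z l ^ \<alpha> l)" if "v \<in> I"
    for v \<alpha> and z :: "nat \<Rightarrow> laurent"
    unfolding inc_def using prod_power_fun_upd_Suc[OF I(1) that] .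
  have sum: "(\<Sum>l\<in>J. inc v \<alpha> l) = (\<Sum>l\<in>J. \<alpha> l) + of_bool (v \<in> J)" if "J \<subseteq> I" for v \<alpha> J
    unfolding inc_def using sum_fun_upd_Suc finite_subset[OF that I(1)] .
  let ?L = "map (\<lambda>(r, \<alpha>). (r, inc j \<alpha>)) L @ map (\<lambda>(r, \<alpha>). (- r, inc i \<alpha>)) L"
  have expansion: "(z j - z i) * F z = (\<Sum>(r, \<alpha>)\<leftarrow>?L. of_int r * (\<Prod>l\<in>I. z l ^ \<alpha> l))" for z
    unfolding L by (induction L) (auto simp: mono I algebra_simps)
  have degrees: "(\<Sum>i\<in>I. \<alpha> i) = w I + of_bool (i \<in> I \<and> j \<in> I) \<and>
      (\<forall>J\<subseteq>I. w J + of_bool (i \<in> J \<and> j \<in> J) \<le> (\<Sum>i\<in>J. \<alpha> i))" if "(r, \<alpha>) \<in> set ?L" for r \<alpha>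
  proof -
    from that obtain \<beta> s v where \<beta>: "(s, \<beta>) \<in> set L" and v: "\<alpha> = inc v \<beta>" "v = i \<or> v = j"
      by auto
    have "w J + of_bool (i \<in> J \<and> j \<in> J) \<le> (\<Sum>i\<in>J. \<alpha> i)" if "J \<subseteq> I" for J
      using wJ[OF \<beta> that] v(2) by (auto simp: v(1) sum[OF that])
    moreover have "(\<Sum>i\<in>I. \<alpha> i) = w I + 1"
      using w[OF \<beta>] v(2) I by (auto simp: v(1) sum)
    ultimately show ?thesis
      using I by simp
  qed
  show ?thesis
    unfolding expands_def
  proof (intro exI[of _ ?L] conjI ballI allI)
    fix p assume "p \<in> set ?L"
    then have p: "(fst p, snd p) \<in> set ?L"
      by (simp only: prod.collapse)
    show "case p of (r, \<alpha>) \<Rightarrow> (\<Sum>i\<in>I. \<alpha> i) = w I + of_bool (i \<in> I \<and> j \<in> I) \<and>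
        (\<forall>J\<subseteq>I. w J + of_bool (i \<in> J \<and> j \<in> J) \<le> (\<Sum>i\<in>J. \<alpha> i))"
      unfolding case_prod_unfold by (rule degrees[OF p])
  qed (rule expansion)
qed

lemma expands_times_difference_power:
  assumes "finite I" "i \<in> I" "j \<in> I" and "expands I F w"
  shows "expands I (\<lambda>z. (z j - z i) ^ c * F z) (\<lambda>J. w J + (if i \<in> J \<and> j \<in> J then c else 0))"
proof (induction c)
  case 0
  then show ?case using assms by simp
next
  case (Suc c)
  have "(\<lambda>J. w J + (if i \<in> J \<and> j \<in> J then c else 0) + of_bool (i \<in> J \<and> j \<in> J))
      = (\<lambda>J. w J + (if i \<in> J \<and> j \<in> J then Suc c else 0))"
    by auto
  then show ?case
    using expands_times_difference[OF assms(1-3) Suc] by (simp add: mult.assoc)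
qed

lemma expands_difference_product:
  assumes I: "finite I" and "finite T" and "T \<subseteq> I \<times> I"
  shows "expands I (\<lambda>z. \<Prod>(i, j)\<in>T. (z j - z i) ^ \<kappa> i j) (\<lambda>J. \<Sum>(i, j)\<in>T \<inter> J \<times> J. \<kappa> i j)"
  using assms(2,3)
proof (induction T rule: finite_induct)
  case empty
  then show ?case using expands_one by simp
next
  case (insert p T)
  obtain i j where p: "p = (i, j)" by fastforce
  with insert have ij: "i \<in> I" "j \<in> I" by auto
  have "(\<Sum>(i, j)\<in>insert p T \<inter> J \<times> J. \<kappa> i j)
      = (\<Sum>(i, j)\<in>T \<inter> J \<times> J. \<kappa> i j) + (if i \<in> J \<and> j \<in> J then \<kappa> i j else 0)" for J
    using insert.hyps by (auto simp: p Int_insert_left)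
  then show ?case
    using expands_times_difference_power[OF I ij, of _ _ "\<kappa> i j"] insert by (simp add: p)
qed

lemma finite_off_diag: "finite S \<Longrightarrow> finite (off_diag S)"
  by (rule finite_subset[of _ "S \<times> S"]) (auto simp: off_diag_def)

lemma off_diag_Int_Times: "J \<subseteq> I \<Longrightarrow> off_diag I \<inter> J \<times> J = off_diag J"
  by (auto simp: off_diag_def)

text \<open>
  The form in which the expansion is used. Its point is that \<open>z\<close> is quantified inside: one expansion is
  evaluated at two different substitutions below.
\<close>

lemma difference_product_expansion:
  assumes I: "finite I"
  shows "\<exists>(N :: nat) (r :: nat \<Rightarrow> int) (\<alpha> :: nat \<Rightarrow> nat \<Rightarrow> nat).
    (\<forall>z :: nat \<Rightarrow> laurent. (\<Prod>(i, j)\<in>off_diag I. (z j - z i) ^ \<kappa> i j)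
      = (\<Sum>t<N. of_int (r t) * (\<Prod>i\<in>I. z i ^ \<alpha> t i))) \<and>
    (\<forall>t<N. (\<Sum>i\<in>I. \<alpha> t i) = (\<Sum>(i, j)\<in>off_diag I. \<kappa> i j) \<and>
      (\<forall>J\<subseteq>I. (\<Sum>(i, j)\<in>off_diag J. \<kappa> i j) \<le> (\<Sum>i\<in>J. \<alpha> t i)))"
proof -
  have "expands I (\<lambda>z. \<Prod>(i, j)\<in>off_diag I. (z j - z i) ^ \<kappa> i j)
      (\<lambda>J. \<Sum>(i, j)\<in>off_diag I \<inter> J \<times> J. \<kappa> i j)"
    by (rule expands_difference_product[OF I finite_off_diag[OF I]]) (auto simp: off_diag_def)
  then obtain L :: "(int \<times> (nat \<Rightarrow> nat)) list" where
    L: "\<forall>z :: nat \<Rightarrow> laurent. (\<Prod>(i, j)\<in>off_diag I. (z j - z i) ^ \<kappa> i j)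
      = (\<Sum>(r, \<alpha>)\<leftarrow>L. of_int r * (\<Prod>i\<in>I. z i ^ \<alpha> i))"
    and w: "\<forall>(r, \<alpha>)\<in>set L. (\<Sum>i\<in>I. \<alpha> i) = (\<Sum>(i, j)\<in>off_diag I \<inter> I \<times> I. \<kappa> i j) \<and>
      (\<forall>J\<subseteq>I. (\<Sum>(i, j)\<in>off_diag I \<inter> J \<times> J. \<kappa> i j) \<le> (\<Sum>i\<in>J. \<alpha> i))"
    unfolding expands_def by blast
  have w: "(\<Sum>i\<in>I. snd (L ! t) i) = (\<Sum>(i, j)\<in>off_diag I. \<kappa> i j) \<and>
      (\<forall>J\<subseteq>I. (\<Sum>(i, j)\<in>off_diag J. \<kappa> i j) \<le> (\<Sum>i\<in>J. snd (L ! t) i))" if "t < length L" for t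
    using w that off_diag_Int_Times by (simp add: case_prod_unfold)
  have L: "(\<Prod>(i, j)\<in>off_diag I. (z j - z i) ^ \<kappa> i j)
      = (\<Sum>t<length L. of_int (fst (L ! t)) * (\<Prod>i\<in>I. z i ^ snd (L ! t) i))" for z :: "nat \<Rightarrow> laurent"
    unfolding L[rule_format] by (simp add: sum_list_sum_nth atLeast0LessThan case_prod_unfold)
  show ?thesis
    by (intro exI[of _ "length L"] exI[of _ "\<lambda>t. fst (L ! t)"] exI[of _ "\<lambda>t. snd (L ! t)"]
        conjI[OF allI[OF L]] allI impI w)
qed

section \<open>Constant terms of products over the variables\<close>

lemma CT_sum: "CT (sum f A) = (\<Sum>x\<in>A. CT (f x))"
  by (simp add: CT_def lookup_sum)

lemma CT_of_int_mult: "CT (of_int c * p) = of_int c * CT p"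
proof -
  have "of_int c * p = Poly_Mapping.map ((*) (of_int c)) p"
    by (metis mult_map_scale_conv_mult single_of_int)
  then show ?thesis by (simp add: CT_def map.rep_eq when_def)
qed

lemma CT_monomial: "CT (Poly_Mapping.single m 1) = of_bool (m = 0)"
  by (simp add: CT_def lookup_single when_def)

lemma X_powi_power: "X_powi i e ^ n = X_powi i (of_nat n * e)"
  by (induction n) (simp_all add: X_powi_0 X_powi_add algebra_simps)

lemma one_minus_X_ratio: "1 - X_ratio i j = X_powi j (- 1) * (X j - X i)"
  using X_powi_inverse[of j] by (simp add: X_ratio_def algebra_simps)

lemma prod_X_powi:
  "(\<Prod>l\<in>I. X_powi (v l) (e l)) = Poly_Mapping.single (\<Sum>l\<in>I. Poly_Mapping.single (v l) (e l)) 1"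
proof (induction I rule: infinite_finite_induct)
  case (insert x F)
  then show ?case by (simp add: X_powi_def mult_single)
qed simp_all

text \<open>
  The exponent of \<open>x\<^sub>v\<close> needs no attention: by homogeneity it vanishes as soon as all the others do.
  This is what makes the constant term of a product over \<open>l\<close> split into a product over \<open>l\<close>, although
  \<open>x\<^sub>v\<close> is shared by all factors.
\<close>

lemma CT_prod_homogeneous_monomials:
  assumes "finite I" and "v \<notin> I" and "(\<Sum>l\<in>I. f l) = 0"
  shows "CT (\<Prod>l\<in>I. X_powi l (e l) * X_powi v (f l - e l)) = of_bool (\<forall>l\<in>I. e l = 0)"
proof -
  let ?m = "(\<Sum>l\<in>I. Poly_Mapping.single l (e l)) + (\<Sum>l\<in>I. Poly_Mapping.single v (f l - e l))"
  have lookup: "Poly_Mapping.lookup ?m l = e l" if "l \<in> I" for l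
    using that assms by (auto simp: lookup_add lookup_sum lookup_single when_def intro!: sum.neutral)
  have "?m = 0" if "\<forall>l\<in>I. e l = 0"
  proof -
    have "(\<Sum>l\<in>I. Poly_Mapping.single v (f l)) = Poly_Mapping.single v (\<Sum>l\<in>I. f l)"
      using assms(1) by (induction I rule: finite_induct) (simp_all add: single_add)
    then show ?thesis using that assms(3) by simp
  qed
  then have "?m = 0 \<longleftrightarrow> (\<forall>l\<in>I. e l = 0)"
    using lookup by (metis lookup_zero)
  moreover have "(\<Prod>l\<in>I. X_powi l (e l) * X_powi v (f l - e l)) = Poly_Mapping.single ?m 1"
    by (simp add: prod.distrib prod_X_powi mult_single)
  ultimately show ?thesis by (simp add: CT_monomial)
qed

lemma CT_prod_homogeneous:
  fixes N :: "nat \<Rightarrow> nat" and e :: "nat \<Rightarrow> nat \<Rightarrow> int"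
  assumes I: "finite I" and v: "v \<notin> I" and f: "(\<Sum>l\<in>I. f l) = 0"
  shows "CT (\<Prod>l\<in>I. \<Sum>t\<le>N l. of_int (g l t) * (X_powi l (e l t) * X_powi v (f l - e l t)))
    = (\<Prod>l\<in>I. \<Sum>t\<le>N l. of_int (g l t) * of_bool (e l t = 0))"
proof -
  have "CT (\<Prod>l\<in>I. \<Sum>t\<le>N l. of_int (g l t) * (X_powi l (e l t) * X_powi v (f l - e l t)))
    = (\<Sum>\<tau>\<in>PiE I (\<lambda>l. {..N l}).
        CT (of_int (\<Prod>l\<in>I. g l (\<tau> l)) * (\<Prod>l\<in>I. X_powi l (e l (\<tau> l)) * X_powi v (f l - e l (\<tau> l)))))"
    by (subst prod_sum_PiE) (use I in \<open>simp_all add: CT_sum prod.distrib\<close>)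
  also have "\<dots> = (\<Sum>\<tau>\<in>PiE I (\<lambda>l. {..N l}). \<Prod>l\<in>I. of_int (g l (\<tau> l)) * of_bool (e l (\<tau> l) = 0))"
    unfolding CT_of_int_mult CT_prod_homogeneous_monomials[OF I v f]
    using I by (intro sum.cong) (auto simp: prod.distrib of_bool_def)
  also have "\<dots> = (\<Prod>l\<in>I. \<Sum>t\<le>N l. of_int (g l t) * of_bool (e l t = 0))"
    by (subst prod_sum_PiE) (use I in simp_all)
  finally show ?thesis .
qed

text \<open>
  The factor that ties \<open>x\<^sub>l\<close> to the base variable \<open>x\<^sub>v\<close>. The base variable is a parameter, since different
  variables play this role in the recursion for \<open>a = b = 0\<close>.
\<close>

definition endpoint_factor :: "nat \<Rightarrow> nat \<Rightarrow> nat \<Rightarrow> nat \<Rightarrow> laurent"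
  where "endpoint_factor v a b l = (1 - X_ratio l v) ^ a * (1 - X_ratio v l) ^ b"

text \<open>
  Up to a sign and a monomial, both parts of \<open>endpoint_factor\<close> are powers of \<open>x\<^sub>l - x\<^sub>v\<close>, so that the
  left-hand side is a single binomial power.
\<close>

lemma endpoint_factor_expansion:
  "X_powi l (int \<beta> - int K) * (X l - X v) ^ \<gamma> * endpoint_factor v a b l
    = (\<Sum>t\<le>\<gamma> + a + b. of_int ((- 1) ^ a * (- 1) ^ (\<gamma> + a + b + t) * int ((\<gamma> + a + b) choose t)) *
        (X_powi l (int t + int \<beta> - int (K + b)) *
         X_powi v (int (\<beta> + \<gamma>) - int K - (int t + int \<beta> - int (K + b)))))"
    (is "_ = (\<Sum>t\<le>?N. ?rhs t)")
proof -
  have "(X v - X l) ^ a = (- 1) ^ a * (X l - X v) ^ a"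
    by (metis minus_diff_eq power_minus)
  then have "X_powi l (int \<beta> - int K) * (X l - X v) ^ \<gamma> * endpoint_factor v a b l
    = (- 1) ^ a * (X_powi l (int \<beta> - int K) * X_powi l (- int b) * X_powi v (- int a) * (X l + - X v) ^ ?N)"
    by (simp add: endpoint_factor_def one_minus_X_ratio power_mult_distrib X_powi_power power_add mult_ac)
  also have "\<dots> = (\<Sum>t\<le>?N. ?rhs t)"
    unfolding binomial_ring sum_distrib_left
  proof (rule sum.cong[OF refl])
    fix t assume "t \<in> {..?N}"
    then have t: "t \<le> ?N" by simp
    have sgn: "(- 1 :: laurent) ^ (?N - t) = (- 1) ^ (?N + t)"
      using t by (simp add: minus_one_power_iff)
    have "(- X v) ^ (?N - t) = (- 1) ^ (?N + t) * X_powi v (int ?N - int t)"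
      unfolding power_minus[of "X v"] sgn X_powi_power using t by (simp add: of_nat_diff)
    moreover have "X l ^ t = X_powi l (int t)"
      by (simp add: X_powi_power)
    ultimately have "(- 1) ^ a * (X_powi l (int \<beta> - int K) * X_powi l (- int b) * X_powi v (- int a) *
        (of_nat (?N choose t) * X l ^ t * (- X v) ^ (?N - t)))
      = of_int ((- 1) ^ a * (- 1) ^ (?N + t) * int (?N choose t)) *
         ((X_powi l (int \<beta> - int K) * X_powi l (- int b) * X_powi l (int t)) *
          (X_powi v (- int a) * X_powi v (int ?N - int t)))"
      by (simp add: mult_ac)
    also have "\<dots> = ?rhs t"
      unfolding X_powi_add by (simp add: algebra_simps)
    finally show "(- 1) ^ a * (X_powi l (int \<beta> - int K) * X_powi l (- int b) * X_powi v (- int a) *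
        (of_nat (?N choose t) * X l ^ t * (- X v) ^ (?N - t))) = ?rhs t" .
  qed
  finally show ?thesis .
qed

text \<open>
  The parameters \<open>\<beta>\<close> and \<open>\<gamma>\<close> cover both substitutions: \<open>\<gamma> = 0\<close> for monomials in the \<open>x\<^sub>l\<close>, and \<open>\<beta> = 0\<close>
  for monomials in the \<open>x\<^sub>l - x\<^sub>v\<close>. The signs cancel because the total degree is the sum of the \<open>K\<^sub>l\<close>.
\<close>

lemma CT_prod_endpoint_factors:
  assumes I: "finite I" and v: "v \<notin> I" and deg: "(\<Sum>l\<in>I. \<beta> l + \<gamma> l) = (\<Sum>l\<in>I. K l)"
  shows "CT (\<Prod>l\<in>I. X_powi l (int (\<beta> l) - int (K l)) * (X l - X v) ^ \<gamma> l * endpoint_factor v a b l)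
    = (\<Prod>l\<in>I. if \<beta> l \<le> K l + b then of_nat ((\<gamma> l + a + b) choose (K l + b - \<beta> l)) else 0)"
proof -
  let ?N = "\<lambda>l. \<gamma> l + a + b"
  let ?c = "\<lambda>l t. (- 1) ^ a * (- 1) ^ (?N l + t) * int (?N l choose t)"
  have deg': "(\<Sum>l\<in>I. int (\<beta> l + \<gamma> l) - int (K l)) = 0"
    using arg_cong[OF deg, of int] by (simp add: sum_subtractf)
  have "CT (\<Prod>l\<in>I. X_powi l (int (\<beta> l) - int (K l)) * (X l - X v) ^ \<gamma> l * endpoint_factor v a b l)
    = (\<Prod>l\<in>I. \<Sum>t\<le>?N l. of_int (?c l t) * of_bool (int t + int (\<beta> l) - int (K l + b) = 0))"
    unfolding endpoint_factor_expansion by (rule CT_prod_homogeneous[OF I v deg'])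
  also have "\<dots> = (\<Prod>l\<in>I. (- 1) ^ (\<beta> l + \<gamma> l) * (- 1) ^ K l *
      (if \<beta> l \<le> K l + b then of_nat (?N l choose (K l + b - \<beta> l)) else 0))"
  proof (rule prod.cong[OF refl])
    fix l
    show "(\<Sum>t\<le>?N l. of_int (?c l t) * of_bool (int t + int (\<beta> l) - int (K l + b) = 0))
      = (- 1) ^ (\<beta> l + \<gamma> l) * (- 1) ^ K l *
        (if \<beta> l \<le> K l + b then of_nat (?N l choose (K l + b - \<beta> l)) else (0::rat))"
    proof (cases "\<beta> l \<le> K l + b")
      case True
      define q where "q = K l + b - \<beta> l"
      have q: "K l + b = q + \<beta> l"
        using True by (simp add: q_def)
      have "(\<Sum>t\<le>?N l. of_int (?c l t) * of_bool (int t + int (\<beta> l) - int (K l + b) = 0))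
          = (\<Sum>t\<le>?N l. if t = q then of_int (?c l t) else (0::rat))"
        by (rule sum.cong) (auto simp: q)
      also have "\<dots> = of_int (?c l q)"
        by (simp add: sum.delta binomial_eq_0)
      also have "(- 1) ^ a * (- 1) ^ (?N l + q) = ((- 1) ^ (\<beta> l + \<gamma> l) * (- 1) ^ K l :: int)"
      proof -
        have "even (a + (?N l + q)) \<longleftrightarrow> even (\<beta> l + \<gamma> l + K l)"
          using arg_cong[OF q, of even] by auto
        then show ?thesis unfolding power_add[symmetric] by (simp add: minus_one_power_iff)
      qed
      finally show ?thesis using True by (simp add: q_def)
    next
      case False
      then show ?thesis by (auto intro!: sum.neutral)
    qed
  qed
  also have "\<dots> = (- 1) ^ (\<Sum>l\<in>I. \<beta> l + \<gamma> l) * (- 1) ^ (\<Sum>l\<in>I. K l) *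
      (\<Prod>l\<in>I. if \<beta> l \<le> K l + b then of_nat (?N l choose (K l + b - \<beta> l)) else 0)"
    by (simp add: prod.distrib power_sum)
  also have "(- 1) ^ (\<Sum>l\<in>I. \<beta> l + \<gamma> l) * (- 1) ^ (\<Sum>l\<in>I. K l) = (1 :: rat)"
    unfolding deg by (simp flip: power_mult_distrib)
  finally show ?thesis by simp
qed

section \<open>Two expansions of the constant term\<close>

definition morris_product :: "nat \<Rightarrow> nat set \<Rightarrow> nat \<Rightarrow> nat \<Rightarrow> (nat \<Rightarrow> nat \<Rightarrow> nat) \<Rightarrow> laurent"
  where "morris_product v I a b \<kappa> =
    (\<Prod>l\<in>I. endpoint_factor v a b l) * (\<Prod>(i, j)\<in>off_diag I. (1 - X_ratio i j) ^ \<kappa> i j)"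

lemma off_diag_eq_Sigma: "off_diag I = prod.swap ` (SIGMA j:I. I - {j})"
  by (auto simp: off_diag_def image_iff)

lemma prod_off_diag:
  "finite I \<Longrightarrow> (\<Prod>(i, j)\<in>off_diag I. f i j) = (\<Prod>j\<in>I. \<Prod>i\<in>I - {j}. f i j)"
  unfolding off_diag_eq_Sigma by (subst prod.reindex) (auto simp: prod.Sigma case_prod_unfold inj_on_def)

lemma sum_off_diag:
  "finite I \<Longrightarrow> (\<Sum>(i, j)\<in>off_diag I. f i j) = (\<Sum>j\<in>I. \<Sum>i\<in>I - {j}. f i j)"
  unfolding off_diag_eq_Sigma by (subst sum.reindex) (auto simp: sum.Sigma case_prod_unfold inj_on_def)

lemma X_powi_sum: "(\<Prod>i\<in>A. X_powi j (e i)) = X_powi j (\<Sum>i\<in>A. e i)"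
  by (induction A rule: infinite_finite_induct) (simp_all add: X_powi_0 X_powi_add)

lemma ratio_product_eq:
  assumes "finite I"
  shows "(\<Prod>(i, j)\<in>off_diag I. (1 - X_ratio i j) ^ \<kappa> i j)
    = (\<Prod>j\<in>I. X_powi j (- int (\<Sum>i\<in>I - {j}. \<kappa> i j))) * (\<Prod>(i, j)\<in>off_diag I. (X j - X i) ^ \<kappa> i j)"
  unfolding prod_off_diag[OF assms] one_minus_X_ratio
  by (simp add: power_mult_distrib prod.distrib X_powi_power X_powi_sum sum_negf)

text \<open>
  Clearing denominators in \<open>1 - x\<^sub>i/x\<^sub>j\<close> costs \<open>x\<^sub>j\<close> the exponent \<open>K\<^sub>j\<close>, and every expansion of the remaining
  product of differences yields a formula for the constant term.
\<close>

lemma CT_morris_product_expansion: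
  fixes r :: "nat \<Rightarrow> int" and \<alpha> \<beta> \<gamma> :: "nat \<Rightarrow> nat \<Rightarrow> nat"
  assumes I: "finite I" and v: "v \<notin> I"
    and expansion: "(\<Prod>(i, j)\<in>off_diag I. (X j - X i) ^ \<kappa> i j)
      = (\<Sum>t<N. of_int (r t) * (\<Prod>i\<in>I. X i ^ \<beta> t i * (X i - X v) ^ \<gamma> t i))"
    and deg: "\<And>t. t < N \<Longrightarrow> (\<Sum>i\<in>I. \<beta> t i + \<gamma> t i) = (\<Sum>(i, j)\<in>off_diag I. \<kappa> i j)"
  defines "K \<equiv> \<lambda>j. \<Sum>i\<in>I - {j}. \<kappa> i j"
  shows "CT (morris_product v I a b \<kappa>) = (\<Sum>t<N. of_int (r t) *
    (\<Prod>l\<in>I. if \<beta> t l \<le> K l + b then of_nat ((\<gamma> t l + a + b) choose (K l + b - \<beta> t l)) else 0))"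
proof -
  have "morris_product v I a b \<kappa> = (\<Sum>t<N. of_int (r t) *
      (\<Prod>l\<in>I. X_powi l (int (\<beta> t l) - int (K l)) * (X l - X v) ^ \<gamma> t l * endpoint_factor v a b l))"
  proof -
    have "X_powi l (int \<beta> - int (K l)) = X_powi l (- int (K l)) * X l ^ \<beta>" for l \<beta>
      by (simp add: X_powi_power X_powi_add)
    then show ?thesis
      unfolding morris_product_def ratio_product_eq[OF I] expansion
      by (simp add: K_def sum_distrib_left prod.distrib mult_ac)
  qed
  then have "CT (morris_product v I a b \<kappa>) = (\<Sum>t<N. of_int (r t) *
      CT (\<Prod>l\<in>I. X_powi l (int (\<beta> t l) - int (K l)) * (X l - X v) ^ \<gamma> t l * endpoint_factor v a b l))"
    by (simp only: CT_sum CT_of_int_mult)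
  also have "\<dots> = (\<Sum>t<N. of_int (r t) *
    (\<Prod>l\<in>I. if \<beta> t l \<le> K l + b then of_nat ((\<gamma> t l + a + b) choose (K l + b - \<beta> t l)) else 0))"
  proof (intro sum.cong refl arg_cong2[where f = "(*)"])
    fix t assume "t \<in> {..<N}"
    then have "(\<Sum>l\<in>I. \<beta> t l + \<gamma> t l) = (\<Sum>l\<in>I. K l)"
      using deg I by (simp add: sum_off_diag K_def)
    then show "CT (\<Prod>l\<in>I. X_powi l (int (\<beta> t l) - int (K l)) * (X l - X v) ^ \<gamma> t l * endpoint_factor v a b l)
      = (\<Prod>l\<in>I. if \<beta> t l \<le> K l + b then of_nat ((\<gamma> t l + a + b) choose (K l + b - \<beta> t l)) else 0)"
      by (rule CT_prod_endpoint_factors[OF I v])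
  qed
  finally show ?thesis .
qed

section \<open>Polynomials in a\<close>

definition binomial_poly :: "nat \<Rightarrow> nat \<Rightarrow> rat poly"
  where "binomial_poly c d = smult (1 / fact d) (\<Prod>s<d. [:of_int (int c - int s), 1:])"

lemma poly_binomial_poly: "poly (binomial_poly c d) (of_nat a) = of_nat ((a + c) choose d)"
proof -
  have "poly (binomial_poly c d) (of_nat a) = (of_nat (a + c) gchoose d)"
    by (simp add: binomial_poly_def poly_prod gbinomial_prod_rev atLeast0LessThan algebra_simps)
  then show ?thesis by (simp add: binomial_gbinomial)
qed

lemma degree_binomial_poly: "degree (binomial_poly c d) \<le> d"
proof -
  have "degree (binomial_poly c d) \<le> degree (\<Prod>s<d. [:of_int (int c - int s), 1 :: rat:])"
    unfolding binomial_poly_def by (rule degree_smult_le)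
  also have "\<dots> \<le> (\<Sum>s<d. (degree \<circ> (\<lambda>s. [:of_int (int c - int s), 1 :: rat:])) s)"
    by (rule degree_prod_sum_le) simp
  also have "\<dots> = d"
    by simp
  finally show ?thesis .
qed

lemma count_image_mset_mset_set:
  assumes "finite A"
  shows "count (image_mset f (mset_set A)) h = card {x\<in>A. f x = h}"
proof -
  have "{x\<in>A. f x = h} = f -` {h} \<inter> A" by auto
  then show ?thesis using assms by (simp add: count_image_mset)
qed

text \<open>
  One product of monic linear factors divides another when its roots, with multiplicity, are among the
  roots of the other. Multiplicities cannot be avoided here: the roots \<open>-(P\<^sub>l + s)\<close> of different \<open>l\<close> coincide once \<open>b\<close> exceeds the gaps
  between the \<open>P\<^sub>l\<close>.
\<close>

lemma prod_linear_dvd: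
  fixes f :: "'a \<Rightarrow> int" and g :: "'b \<Rightarrow> int"
  assumes "finite A" "finite B"
    and count: "\<And>h. card {x\<in>A. f x = h} \<le> card {x\<in>B. g x = h}"
  shows "(\<Prod>x\<in>A. [:of_int (f x), 1 :: rat:]) dvd (\<Prod>x\<in>B. [:of_int (g x), 1:])"
proof -
  have "count (image_mset f (mset_set A)) h \<le> count (image_mset g (mset_set B)) h" for h
    using count[of h] by (simp only: count_image_mset_mset_set assms(1,2))
  then have "image_mset (\<lambda>h. [:of_int h, 1 :: rat:]) (image_mset f (mset_set A))
      \<subseteq># image_mset (\<lambda>h. [:of_int h, 1 :: rat:]) (image_mset g (mset_set B))"
    by (intro image_mset_subseteq_mono mset_subset_eqI)
  then have "prod_mset (image_mset (\<lambda>h. [:of_int h, 1 :: rat:]) (image_mset f (mset_set A)))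
      dvd prod_mset (image_mset (\<lambda>h. [:of_int h, 1 :: rat:]) (image_mset g (mset_set B)))"
    by (rule prod_mset_subset_imp_dvd)
  then show ?thesis
    by (simp add: image_mset.compositionality comp_def prod_unfold_prod_mset)
qed

section \<open>Counting roots\<close>

text \<open>
  The numerical conditions on \<open>P\<close> under which the exponents \<open>\<alpha>\<close> of the expansion produce the roots
  \<open>-(P\<^sub>l + s)\<close>. In the first condition \<open>J\<close> is a set of variables all of whose exponents are at most \<open>M\<close>;
  in the second, a set whose complement consists of variables \<open>i\<close> with exponent at least \<open>h + K\<^sub>i\<close>.
\<close>

definition root_profile :: "nat set \<Rightarrow> (nat \<Rightarrow> nat \<Rightarrow> nat) \<Rightarrow> (nat \<Rightarrow> nat) \<Rightarrow> bool"
  where "root_profile I \<kappa> P \<longleftrightarrow> mono P \<and>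
    (\<forall>J M. J \<subseteq> I \<longrightarrow> J \<noteq> {} \<longrightarrow>
      (\<Sum>(i, j)\<in>off_diag J. \<kappa> i j) \<le> card J * M \<longrightarrow> P (card J - 1) \<le> M) \<and>
    (\<forall>J h. J \<subset> I \<longrightarrow>
      card (I - J) * h + (\<Sum>(i, j)\<in>off_diag J. \<kappa> i j) \<le> (\<Sum>j\<in>J. \<Sum>i\<in>I - {j}. \<kappa> i j) \<longrightarrow> h \<le> P (card J))"

text \<open>
  As a polynomial in \<open>a\<close>, the binomial \<open>a + b + \<alpha>\<^sub>i\<close> choose \<open>K\<^sub>i + b\<close> has the root \<open>-h\<close> exactly when
  \<open>\<alpha>\<^sub>i - K\<^sub>i < h \<le> b + \<alpha>\<^sub>i\<close>. Such a variable is lost in one of two ways, by having a small or a large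
  exponent, and few variables are lost in either way: a large set of small exponents would violate the
  lower bound for the monomial on that set, and a large set of large exponents would leave too little
  for its complement. The indices \<open>l\<close> with \<open>-h\<close> not among \<open>-(P\<^sub>l + 1), \<dots>, -(P\<^sub>l + b)\<close> fall into the same
  two kinds, so it suffices to compare kind by kind.
\<close>

lemma root_profile_window_count:
  fixes \<alpha> :: "nat \<Rightarrow> nat" and h :: nat
  assumes I: "finite I" and profile: "root_profile I \<kappa> P"
    and total: "(\<Sum>i\<in>I. \<alpha> i) = (\<Sum>(i, j)\<in>off_diag I. \<kappa> i j)"
    and sub: "\<And>J. J \<subseteq> I \<Longrightarrow> (\<Sum>(i, j)\<in>off_diag J. \<kappa> i j) \<le> (\<Sum>i\<in>J. \<alpha> i)"
  defines "K \<equiv> \<lambda>j. \<Sum>i\<in>I - {j}. \<kappa> i j"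
  shows "card {l\<in>{..<card I}. P l < h \<and> h \<le> P l + b} \<le> card {i\<in>I. \<alpha> i < h + K i \<and> h \<le> b + \<alpha> i}"
proof -
  let ?n = "card I"
  define w where "w J = (\<Sum>(i, j)\<in>off_diag J. \<kappa> i j)" for J
  define A where "A = {l\<in>{..<?n}. P l + b < h}"
  define B where "B = {l\<in>{..<?n}. h \<le> P l}"
  define C where "C = {l\<in>{..<?n}. P l < h \<and> h \<le> P l + b}"
  define L where "L = {i\<in>I. b + \<alpha> i < h}"
  define H where "H = {i\<in>I. h + K i \<le> \<alpha> i}"
  define W where "W = {i\<in>I. \<alpha> i < h + K i \<and> h \<le> b + \<alpha> i}"
  have fin: "finite A" "finite B" "finite C" "finite L" "finite H" "finite W"
    using I by (auto simp: A_def B_def C_def L_def H_def W_def)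
  have mono: "P l \<le> P l'" if "l \<le> l'" for l l'
    using profile that by (auto simp: root_profile_def mono_def)
  have total': "(\<Sum>i\<in>I. \<alpha> i) = (\<Sum>i\<in>I. K i)"
    using total I by (simp add: sum_off_diag K_def)
  have "{..<?n} = A \<union> B \<union> C"
    by (auto simp: A_def B_def C_def)
  moreover have "A \<inter> B = {}" "(A \<union> B) \<inter> C = {}"
    by (auto simp: A_def B_def C_def)
  ultimately have split: "?n = card A + card B + card C"
    using fin by (metis card_Un_disjoint card_lessThan finite_UnI)
  have "I = L \<union> H \<union> W"
    by (auto simp: L_def H_def W_def)
  moreover have "L \<inter> H = {}" "(L \<union> H) \<inter> W = {}"
    by (auto simp: L_def H_def W_def)
  ultimately have split': "?n = card L + card H + card W"
    using fin by (metis card_Un_disjoint finite_UnI)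
  have "card L \<le> card A"
  proof (cases "L = {}")
    case False
    have LI: "L \<subseteq> I" by (auto simp: L_def)
    have cardL: "0 < card L" "card L \<le> ?n"
      using False fin I LI by (auto simp: card_gt_0_iff card_mono)
    obtain i where "i \<in> L" using False by auto
    then have hb: "b < h" by (auto simp: L_def)
    have "w L \<le> (\<Sum>i\<in>L. \<alpha> i)"
      using sub[OF LI] by (simp add: w_def)
    also have "\<dots> \<le> card L * (h - b - 1)"
    proof -
      have "\<alpha> i \<le> h - b - 1" if "i \<in> L" for i
        using that unfolding L_def by simp linarith
      then show ?thesis
        using sum_bounded_above[of L \<alpha> "h - b - 1"] by simp
    qed
    finally have "P (card L - 1) \<le> h - b - 1"
      using profile LI False by (auto simp: root_profile_def w_def)
    then have "P (card L - 1) + b < h"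
      using hb by linarith
    then have "P l + b < h" if "l < card L" for l
      using mono[of l "card L - 1"] that by linarith
    then have "{..<card L} \<subseteq> A"
      using cardL by (auto simp: A_def)
    then have "card {..<card L} \<le> card A"
      by (rule card_mono[OF fin(1)])
    then show ?thesis by simp
  qed simp
  moreover have "card H \<le> card B"
  proof (cases "H = {}")
    case False
    have HI: "H \<subseteq> I" by (auto simp: H_def)
    define J where "J = I - H"
    have J: "J \<subset> I" "I - J = H" using False HI by (auto simp: J_def)
    have finJ: "finite J" using I by (simp add: J_def)
    have cardJ: "card J + card H = ?n"
      using I HI fin(5) by (simp add: J_def card_Diff_subset card_mono)
    have splitI: "sum f I = sum f J + sum f H" for f :: "nat \<Rightarrow> nat"
      using sum.subset_diff[OF HI I] by (simp add: J_def)
    have "card H * h + (\<Sum>i\<in>H. K i) = (\<Sum>i\<in>H. h + K i)"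
      by (simp add: sum.distrib)
    also have "\<dots> \<le> (\<Sum>i\<in>H. \<alpha> i)"
      by (rule sum_mono) (simp add: H_def)
    finally have "card H * h + (\<Sum>i\<in>H. K i) \<le> (\<Sum>i\<in>H. \<alpha> i)" .
    moreover have "w J \<le> (\<Sum>i\<in>J. \<alpha> i)"
      using sub[of J] J by (auto simp: w_def)
    ultimately have "card H * h + w J \<le> (\<Sum>i\<in>J. K i)"
      using splitI[of \<alpha>] splitI[of K] total' by linarith
    then have "h \<le> P (card J)"
      using profile J by (simp add: root_profile_def w_def K_def)
    then have "h \<le> P l" if "card J \<le> l" for l
      using mono[OF that] by linarith
    then have "{card J..<?n} \<subseteq> B"
      by (auto simp: B_def)
    then have "card {card J..<?n} \<le> card B"
      by (rule card_mono[OF fin(2)])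
    then show ?thesis
      using cardJ by simp
  qed simp
  ultimately have "card C \<le> card W"
    using split split' by linarith
  then show ?thesis
    by (simp only: C_def W_def)
qed

text \<open>
  The same count in terms of the linear factors themselves, the shape required by \<open>prod_linear_dvd\<close>.
\<close>

lemma root_profile_root_count:
  fixes \<alpha> :: "nat \<Rightarrow> nat" and h :: int
  assumes I: "finite I" and profile: "root_profile I \<kappa> P"
    and total: "(\<Sum>i\<in>I. \<alpha> i) = (\<Sum>(i, j)\<in>off_diag I. \<kappa> i j)"
    and sub: "\<And>J. J \<subseteq> I \<Longrightarrow> (\<Sum>(i, j)\<in>off_diag J. \<kappa> i j) \<le> (\<Sum>i\<in>J. \<alpha> i)"
  defines "K \<equiv> \<lambda>j. \<Sum>i\<in>I - {j}. \<kappa> i j"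
  shows "card {x\<in>{..<card I} \<times> {..<b}. int (P (fst x) + snd x + 1) = h}
    \<le> card {x\<in>SIGMA i:I. {..<K i + b}. int (b + \<alpha> (fst x)) - int (snd x) = h}"
proof (cases "1 \<le> h")
  case True
  define m where "m = nat h"
  have m: "h = int m" "1 \<le> m" using True by (auto simp: m_def)
  have finite: "finite {x\<in>SIGMA i:I. {..<K i + b}. int (b + \<alpha> (fst x)) - int (snd x) = h}"
    using I by (intro finite_subset[OF _ finite_SigmaI[of I "\<lambda>i. {..<K i + b}"]]) auto
  have "card {x\<in>{..<card I} \<times> {..<b}. int (P (fst x) + snd x + 1) = h}
      \<le> card {l\<in>{..<card I}. P l < m \<and> m \<le> P l + b}"
    by (rule card_inj_on_le[where f = fst]) (auto simp: m inj_on_def)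
  also have "\<dots> \<le> card {i\<in>I. \<alpha> i < m + K i \<and> m \<le> b + \<alpha> i}"
    unfolding K_def by (rule root_profile_window_count[OF I profile total sub])
  also have "\<dots> \<le> card {x\<in>SIGMA i:I. {..<K i + b}. int (b + \<alpha> (fst x)) - int (snd x) = h}"
    by (rule card_inj_on_le[where f = "\<lambda>i. (i, b + \<alpha> i - m)"]) (use finite in \<open>auto simp: m inj_on_def\<close>)
  finally show ?thesis .
next
  case False
  then have "{x\<in>{..<card I} \<times> {..<b}. int (P (fst x) + snd x + 1) = h} = {}"
    by auto
  then show ?thesis by (simp only: card.empty le0)
qed

lemma poly_eqI_of_nat:
  fixes p q :: "rat poly"
  assumes "\<And>a :: nat. poly p (of_nat a) = poly q (of_nat a)"
  shows "p = q"
proof -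
  have "range (of_nat :: nat \<Rightarrow> rat) \<subseteq> {x. poly (p - q) x = 0}"
    using assms by auto
  then have "infinite {x. poly (p - q) x = 0}"
    using infinite_super range_inj_infinite[OF inj_of_nat] by blast
  then show ?thesis
    using poly_roots_finite[of "p - q"] by auto
qed

lemma prod_shift_eq_fact_quotient:
  "(\<Prod>s<b. of_nat (c + s + 1)) = (fact (c + b) / fact c :: rat)"
proof (induction b)
  case (Suc b)
  have "fact (c + Suc b) = of_nat (c + b + 1) * (fact (c + b) :: rat)"
    by (simp only: add_Suc_right fact_Suc flip: Suc_eq_plus1)
  then show ?case
    by (simp only: prod.lessThan_Suc Suc.IH mult.commute times_divide_eq_right)
qed simp

section \<open>The dependence on a and b\<close>

text \<open>
  The polynomial \<open>p1\<close> below has degree at most \<open>n b\<close>, and \<open>p2\<close> is divisible by the product \<open>R\<close> of degree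
  \<open>n b\<close>. They agree at all natural numbers, hence are equal and a constant multiple of \<open>R\<close>. The constant
  is read off at \<open>a = 0\<close>, where the value does not depend on \<open>b\<close>.
\<close>

theorem CT_morris_product:
  assumes I: "finite I" and v: "v \<notin> I" and profile: "root_profile I \<kappa> P"
  shows "CT (morris_product v I a b \<kappa>) = CT (\<Prod>(i, j)\<in>off_diag I. (1 - X_ratio i j) ^ \<kappa> i j) *
    (\<Prod>l<card I. (fact (a + b + P l) * fact (P l)) / (fact (a + P l) * fact (b + P l)))"
proof -
  define K where "K j = (\<Sum>i\<in>I - {j}. \<kappa> i j)" for j
  let ?n = "card I"
  obtain N :: nat and r :: "nat \<Rightarrow> int" and \<alpha> :: "nat \<Rightarrow> nat \<Rightarrow> nat"
    where expansion: "\<forall>z :: nat \<Rightarrow> laurent. (\<Prod>(i, j)\<in>off_diag I. (z j - z i) ^ \<kappa> i j)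
      = (\<Sum>t<N. of_int (r t) * (\<Prod>i\<in>I. z i ^ \<alpha> t i))"
    and degrees: "\<forall>t<N. (\<Sum>i\<in>I. \<alpha> t i) = (\<Sum>(i, j)\<in>off_diag I. \<kappa> i j) \<and>
      (\<forall>J\<subseteq>I. (\<Sum>(i, j)\<in>off_diag J. \<kappa> i j) \<le> (\<Sum>i\<in>J. \<alpha> t i))"
    using difference_product_expansion[OF I, of \<kappa>] by blast
  have deg: "(\<Sum>i\<in>I. \<alpha> t i) = (\<Sum>(i, j)\<in>off_diag I. \<kappa> i j)" if "t < N" for t
    using degrees that by blast
  have sub: "(\<Sum>(i, j)\<in>off_diag J. \<kappa> i j) \<le> (\<Sum>i\<in>J. \<alpha> t i)" if "t < N" "J \<subseteq> I" for t J
    using degrees that by blast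
  have total: "(\<Sum>i\<in>I. \<alpha> t i) = (\<Sum>i\<in>I. K i)" if "t < N" for t
    using deg[OF that] I by (simp add: sum_off_diag K_def)
  have CT1: "CT (morris_product v I a b \<kappa>) = (\<Sum>t<N. of_int (r t) *
      (\<Prod>l\<in>I. if \<alpha> t l \<le> K l + b then of_nat ((a + b) choose (K l + b - \<alpha> t l)) else 0))" for a b
    using CT_morris_product_expansion[OF I v, where \<kappa> = \<kappa> and N = N and r = r and \<beta> = \<alpha> and \<gamma> = "\<lambda>_ _. 0" and a = a and b = b] spec[OF expansion, of X] deg
    by (simp add: K_def cong: if_cong)
  have CT2: "CT (morris_product v I a b \<kappa>) = (\<Sum>t<N. of_int (r t) *
      (\<Prod>l\<in>I. of_nat ((\<alpha> t l + a + b) choose (K l + b))))" for a b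
    using CT_morris_product_expansion[OF I v, where \<kappa> = \<kappa> and N = N and r = r and \<beta> = "\<lambda>_ _. 0" and \<gamma> = \<alpha> and a = a and b = b]
      spec[OF expansion, of "\<lambda>i. X i - X v"] deg by (simp add: K_def)
  \<comment> \<open>the substitutions \<open>z\<^sub>i = x\<^sub>i\<close> and \<open>z\<^sub>i = x\<^sub>i - x\<^sub>v\<close>, as polynomials in \<open>a\<close>\<close>
  define p1 where "p1 = (\<Sum>t<N. smult (of_int (r t))
      (\<Prod>l\<in>I. if \<alpha> t l \<le> K l + b then binomial_poly b (K l + b - \<alpha> t l) else 0))"
  define p2 where "p2 = (\<Sum>t<N. smult (of_int (r t)) (\<Prod>l\<in>I. binomial_poly (b + \<alpha> t l) (K l + b)))"
  define R where "R = (\<Prod>x\<in>{..<?n} \<times> {..<b}. [:of_int (int (P (fst x) + snd x + 1)), 1 :: rat:])"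
  have p1: "poly p1 (of_nat a) = CT (morris_product v I a b \<kappa>)" for a
    unfolding CT1 p1_def
    by (simp add: poly_sum poly_prod poly_binomial_poly if_distrib[of "\<lambda>p. poly p _"] cong: if_cong)
  have p2: "poly p2 (of_nat a) = CT (morris_product v I a b \<kappa>)" for a
    unfolding CT2 p2_def by (simp add: poly_sum poly_prod poly_binomial_poly add_ac)
  have p1_eq_p2: "p1 = p2"
    by (rule poly_eqI_of_nat) (simp add: p1 p2)
  have "R dvd p1"
    unfolding p1_eq_p2 p2_def
  proof (intro dvd_sum dvd_smult)
    fix t assume "t \<in> {..<N}"
    then have t: "t < N" by simp
    have "R dvd (\<Prod>x\<in>Sigma I (\<lambda>l. {..<K l + b}). [:of_int (int (b + \<alpha> t (fst x)) - int (snd x)), 1:])"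
      unfolding R_def K_def using I
      by (intro prod_linear_dvd root_profile_root_count[OF I profile deg[OF t] sub[OF t]]) auto
    also have "\<dots> = (\<Prod>l\<in>I. \<Prod>s<K l + b. [:of_int (int (b + \<alpha> t l) - int s), 1:])"
      using I by (subst prod.Sigma) (auto simp: case_prod_unfold)
    also have "\<dots> dvd (\<Prod>l\<in>I. binomial_poly (b + \<alpha> t l) (K l + b))"
      unfolding binomial_poly_def by (intro prod_dvd_prod dvd_smult) simp
    finally show "R dvd (\<Prod>l\<in>I. binomial_poly (b + \<alpha> t l) (K l + b))" .
  qed
  then obtain q where q: "p1 = R * q"
    by (rule dvdE)
  have degR: "degree R = ?n * b"
    unfolding R_def by (subst degree_prod_sum_eq) (auto simp: card_cartesian_product)
  have R0: "R \<noteq> 0"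
    unfolding R_def by simp
  have "degree p1 \<le> ?n * b"
    unfolding p1_def
  proof (intro degree_sum_le order.trans[OF degree_smult_le])
    fix t assume "t \<in> {..<N}"
    then have t: "t < N" by simp
    show "degree (\<Prod>l\<in>I. if \<alpha> t l \<le> K l + b then binomial_poly b (K l + b - \<alpha> t l) else 0) \<le> ?n * b"
    proof (cases "\<forall>l\<in>I. \<alpha> t l \<le> K l + b")
      case True
      have "degree (\<Prod>l\<in>I. binomial_poly b (K l + b - \<alpha> t l))
          \<le> (\<Sum>l\<in>I. (degree \<circ> (\<lambda>l. binomial_poly b (K l + b - \<alpha> t l))) l)"
        by (rule degree_prod_sum_le[OF I])
      also have "\<dots> \<le> (\<Sum>l\<in>I. K l + b - \<alpha> t l)"
        by (rule sum_mono) (simp add: degree_binomial_poly)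
      also have "\<dots> = (\<Sum>l\<in>I. K l + b) - (\<Sum>l\<in>I. \<alpha> t l)"
        by (rule sum_subtractf_nat) (use True in simp)
      also have "\<dots> = ?n * b"
        using total[OF t] by (simp add: sum.distrib)
      finally show ?thesis using True by simp
    next
      case False
      then obtain l where "l \<in> I" "\<not> \<alpha> t l \<le> K l + b" by blast
      then have "(\<Prod>l\<in>I. if \<alpha> t l \<le> K l + b then binomial_poly b (K l + b - \<alpha> t l) else 0) = 0"
        using I by (intro prod_zero) auto
      then show ?thesis by simp
    qed
  qed simp
  then have "degree q = 0"
    using q degR R0 by (cases "q = 0") (simp_all add: degree_mult_eq)
  then obtain c where c: "q = [:c:]"
    by (rule degree_eq_zeroE)
  have eval_R: "poly R (of_nat a) = (\<Prod>l<?n. fact (a + b + P l) / fact (a + P l))" for a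
  proof -
    have "poly R (of_nat a) = (\<Prod>l<?n. \<Prod>s<b. of_nat (a + P l + s + 1))"
      unfolding R_def poly_prod by (subst prod.cartesian_product) (simp add: case_prod_unfold add_ac)
    then show ?thesis
      unfolding prod_shift_eq_fact_quotient by (simp add: add_ac)
  qed
  have CT_eq: "CT (morris_product v I a b \<kappa>) = c * (\<Prod>l<?n. fact (a + b + P l) / fact (a + P l))" for a
    unfolding p1[symmetric] q c by (simp add: eval_R)
  have CT_0: "CT (morris_product v I 0 b \<kappa>) = (\<Sum>t<N. of_int (r t) * of_bool (\<forall>l\<in>I. \<alpha> t l = K l))" for b
    unfolding CT1
  proof (intro sum.cong refl arg_cong2[where f = "(*)"])
    fix t assume "t \<in> {..<N}"
    then have t: "t < N" by simp
    show "(\<Prod>l\<in>I. if \<alpha> t l \<le> K l + b then of_nat ((0 + b) choose (K l + b - \<alpha> t l)) else 0)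
        = (of_bool (\<forall>l\<in>I. \<alpha> t l = K l) :: rat)"
    proof (cases "\<forall>l\<in>I. \<alpha> t l = K l")
      case False
      \<comment> \<open>the two exponent vectors have the same sum; a smaller entry makes the lower index of its binomial exceed \<open>b\<close>\<close>
      have "\<exists>l\<in>I. \<alpha> t l < K l"
      proof (rule ccontr)
        assume "\<not> (\<exists>l\<in>I. \<alpha> t l < K l)"
        then have ge: "\<forall>l\<in>I. K l \<le> \<alpha> t l"
          by (simp add: not_less)
        with False have gt: "\<exists>l\<in>I. K l < \<alpha> t l"
          using le_neq_implies_less by metis
        have "(\<Sum>l\<in>I. K l) < (\<Sum>l\<in>I. \<alpha> t l)"
          by (rule sum_strict_mono_ex1[OF I ge gt])
        then show False using total[OF t] by simp
      qed
      then obtain l where "l \<in> I" "\<alpha> t l < K l" by blast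
      then have "(\<Prod>l\<in>I. if \<alpha> t l \<le> K l + b then of_nat ((0 + b) choose (K l + b - \<alpha> t l)) else 0) = (0 :: rat)"
        using I by (intro prod_zero bexI[of _ l]) (auto simp: binomial_eq_0)
      then show ?thesis using False by simp
    qed simp
  qed
  have "morris_product v I 0 0 \<kappa> = (\<Prod>(i, j)\<in>off_diag I. (1 - X_ratio i j) ^ \<kappa> i j)"
    by (simp add: morris_product_def endpoint_factor_def)
  then have "CT (\<Prod>(i, j)\<in>off_diag I. (1 - X_ratio i j) ^ \<kappa> i j) = c * (\<Prod>l<?n. fact (b + P l) / fact (P l))"
    using CT_eq[of 0] CT_0[of b] CT_0[of 0] by simp
  then show ?thesis
    unfolding CT_eq mult.assoc by (simp flip: prod.distrib)
qed

section \<open>Root profiles for one distinguished block\<close>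

text \<open>
  The block \<open>S\<close> contributes an additional factor \<open>1 - x\<^sub>i/x\<^sub>j\<close> to each of its ordered pairs.
\<close>

definition forrester_exponent :: "nat \<Rightarrow> nat set \<Rightarrow> nat \<Rightarrow> nat \<Rightarrow> nat"
  where "forrester_exponent k S i j = k + of_bool (i \<in> S \<and> j \<in> S)"

text \<open>
  Subtraction is truncated: the gap between consecutive values is \<open>k\<close> up to the index \<open>n0\<close> and \<open>k + 1\<close>
  from there on. In the two lemmas on \<open>forrester_root\<close> below, \<open>j\<close> is the size of a set of variables,
  \<open>s\<close> the number of those that lie in the block, \<open>m\<close> the size of the block and \<open>n0\<close> the number of
  variables outside it.
\<close>

definition forrester_root :: "nat \<Rightarrow> nat \<Rightarrow> nat \<Rightarrow> nat"
  where "forrester_root k n0 l = k * l + (l - n0)"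

lemma sum_off_diag_forrester_exponent:
  assumes "finite J"
  shows "(\<Sum>(i, j)\<in>off_diag J. forrester_exponent k S i j)
    = k * (card J * (card J - 1)) + card (J \<inter> S) * (card (J \<inter> S) - 1)"
proof -
  have "(\<Sum>i\<in>J - {j}. forrester_exponent k S i j)
      = k * (card J - 1) + (if j \<in> S then card (J \<inter> S) - 1 else 0)" if "j \<in> J" for j
  proof -
    have "(J - {j}) \<inter> S = J \<inter> S - {j}" by auto
    then show ?thesis
      using assms that by (auto simp: forrester_exponent_def sum.distrib of_bool_def card_Diff_singleton_if
        simp flip: sum.inter_restrict)
  qed
  then show ?thesis
    using assms by (simp add: sum_off_diag sum.distrib algebra_simps flip: sum.inter_restrict)
qed

lemma sum_forrester_exponent:
  assumes "finite I" "J \<subseteq> I" "S \<subseteq> I"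
  shows "(\<Sum>j\<in>J. \<Sum>i\<in>I - {j}. forrester_exponent k S i j)
    = k * (card J * (card I - 1)) + card (J \<inter> S) * (card S - 1)"
proof -
  have "finite J" using assms finite_subset by blast
  have "(\<Sum>i\<in>I - {j}. forrester_exponent k S i j)
      = k * (card I - 1) + (if j \<in> S then card S - 1 else 0)" if "j \<in> J" for j
  proof -
    have "(I - {j}) \<inter> S = S - {j}" "j \<in> I" using assms that by auto
    then show ?thesis
      using assms that by (auto simp: forrester_exponent_def sum.distrib of_bool_def card_Diff_singleton_if
        simp flip: sum.inter_restrict)
  qed
  then show ?thesis
    using \<open>finite J\<close> by (simp add: sum.distrib algebra_simps flip: sum.inter_restrict)
qed

text \<open>
  The average of \<open>\<alpha>\<close> over \<open>j\<close> variables is at least \<open>k (j - 1) + s (s - 1) / j\<close>, while the bound asks for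
  \<open>j - 1 - n0\<close> in place of the last summand. With \<open>s \<ge> j - n0\<close> this average falls short of it by less
  than one when \<open>n0 \<le> 1\<close>, and integrality closes the gap. When \<open>m \<le> 2\<close>, the only case to consider is
  \<open>j = n0 + 2\<close>, where \<open>s = 2\<close>.
\<close>

lemma forrester_root_lower_bound:
  fixes j s k M n0 m :: nat
  assumes j: "0 < j" "j \<le> s + n0" and s: "s \<le> m" and cases: "n0 \<le> 1 \<or> m \<le> 2"
    and le: "k * (j * (j - 1)) + s * (s - 1) \<le> j * M"
  shows "forrester_root k n0 (j - 1) \<le> M"
proof (rule ccontr)
  assume "\<not> ?thesis"
  then have "M + 1 \<le> k * (j - 1) + (j - 1 - n0)"
    by (simp add: forrester_root_def)
  then have "j * (M + 1) \<le> j * (k * (j - 1) + (j - 1 - n0))"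
    by (rule mult_le_mono2)
  then have "j * M + j \<le> k * (j * (j - 1)) + j * (j - 1 - n0)"
    by (simp only: add_mult_distrib2 mult_1_right mult.left_commute[of j k])
  then have gap: "s * (s - 1) + j \<le> j * (j - 1 - n0)"
    using le by linarith
  \<comment> \<open>otherwise the right-hand side of \<open>gap\<close> is zero\<close>
  then have large: "n0 + 1 < j"
    using j(1) by (cases "j - 1 - n0") auto
  show False
  proof (cases "m \<le> 2")
    case True
    then have "j = n0 + 2" "s = 2"
      using large j s by auto
    then show False using gap by simp
  next
    case False
    then have n0: "n0 \<le> 1" using cases by blast
    have "(j - n0) * (j - n0 - 1) \<le> s * (s - 1)"
      using j by (intro mult_le_mono) auto
    then have "(j - n0) * (j - n0 - 1) + j \<le> j * (j - n0 - 1)"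
      using gap by (simp add: diff_right_commute)
    moreover have "j * (j - n0 - 1) = (j - n0) * (j - n0 - 1) + n0 * (j - n0 - 1)"
      using large by (metis add_mult_distrib le_add_diff_inverse2 add_leE less_or_eq_imp_le)
    ultimately have "j \<le> n0 * (j - n0 - 1)"
      by linarith
    also have "\<dots> \<le> 1 * (j - n0 - 1)"
      using n0 by (rule mult_le_mono1)
    finally show False using large by simp
  qed
qed

text \<open>
  After cancellation the hypothesis reads \<open>h \<le> k j + s (m - s) / d\<close> with \<open>d = n0 + m - j\<close>, and by
  integrality it is enough that the fraction is less than \<open>j - n0 + 1\<close>.
\<close>

lemma forrester_root_upper_bound:
  fixes j s k h n0 m :: nat
  assumes j: "s \<le> j" "j \<le> s + n0" "j < n0 + m" and s: "s \<le> m" and cases: "n0 \<le> 1 \<or> m \<le> 2"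
    and le: "(n0 + m - j) * h + (k * (j * (j - 1)) + s * (s - 1)) \<le> k * (j * (n0 + m - 1)) + s * (m - 1)"
  shows "h \<le> forrester_root k n0 j"
proof (rule ccontr)
  assume "\<not> ?thesis"
  then have h: "k * j + (j - n0) + 1 \<le> h"
    by (simp add: forrester_root_def)
  define d where "d = n0 + m - j"
  have d: "n0 + m = d + j" "0 < d" using j by (auto simp: d_def)
  have 1: "k * (j * (n0 + m - 1)) = d * (k * j) + k * (j * (j - 1))"
    unfolding d by (cases j) (simp_all add: algebra_simps)
  have "s * (m - 1) = s * (m - s) + s * (s - 1)"
    using s by (cases s) (simp_all flip: add_mult_distrib2)
  then have "d * h \<le> d * (k * j) + s * (m - s)"
    using le 1 by (simp add: d_def[symmetric])
  moreover have "d * (k * j + (j - n0) + 1) \<le> d * h"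
    using h by (rule mult_le_mono2)
  ultimately have gap: "d * (j - n0 + 1) \<le> s * (m - s)"
    by (simp add: algebra_simps)
  show False
  proof (cases "m \<le> 2")
    case True
    then have "m - s = 0 \<or> s = 0 \<or> s = 1 \<and> m = 2"
      using s by auto
    then have "s = 1" "m = 2" "d * (j - n0 + 1) = 1"
      using gap d(2) by (auto simp: le_Suc_eq)
    then have "d = 1" "j - n0 = 0"
      by (simp_all only: nat_mult_eq_1_iff) simp_all
    then show False using d(1) \<open>m = 2\<close> by simp
  next
    case False
    then have n0: "n0 \<le> 1" using cases by blast
    have bounds: "m - s \<le> d" "s \<le> j - n0 + 1"
      using j s n0 by (auto simp: d_def)
    have "m - s < d \<and> 0 < s \<or> s < j - n0 + 1"
      using j s n0 by (auto simp: d_def)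
    then have "s * (m - s) < (j - n0 + 1) * d"
    proof
      assume "m - s < d \<and> 0 < s"
      then have "s * (m - s) < s * d" by simp
      also have "\<dots> \<le> (j - n0 + 1) * d" using bounds(2) by (rule mult_le_mono1)
      finally show ?thesis .
    next
      assume "s < j - n0 + 1"
      have "s * (m - s) \<le> s * d" using bounds(1) by (rule mult_le_mono2)
      also have "\<dots> < (j - n0 + 1) * d" using \<open>s < j - n0 + 1\<close> d(2) by (rule mult_less_mono1)
      finally show ?thesis .
    qed
    then show False using gap by (simp add: mult.commute)
  qed
qed

text \<open>
  Both conditions of \<open>root_profile\<close> see a set \<open>J\<close> only through its size and the size of its intersection
  with the block, which reduces them to the two arithmetical bounds.
\<close>

lemma root_profile_forrester:
  assumes I: "finite I" "S \<subseteq> I" and cases: "card (I - S) \<le> 1 \<or> card S \<le> 2"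
  shows "root_profile I (forrester_exponent k S) (forrester_root k (card (I - S)))"
  unfolding root_profile_def
proof (intro conjI allI impI)
  let ?n0 = "card (I - S)"
  have finS: "finite S" using I finite_subset by blast
  have cardI: "card I = ?n0 + card S"
    using card_Diff_subset[OF finS I(2)] card_mono[OF I] by simp
  have bounds: "card (J \<inter> S) \<le> card J" "card J \<le> card (J \<inter> S) + ?n0" "card (J \<inter> S) \<le> card S"
    if "J \<subseteq> I" for J
  proof -
    have J: "finite J" using that I(1) finite_subset by blast
    have "card J = card (J \<inter> S) + card (J - S)"
      using J by (metis Int_Diff_disjoint Int_Diff_Un card_Un_disjoint finite_Diff finite_Int)
    moreover have "card (J - S) \<le> ?n0"
      using that I(1) by (intro card_mono) auto
    ultimately show "card (J \<inter> S) \<le> card J" "card J \<le> card (J \<inter> S) + ?n0"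
      by simp_all
    show "card (J \<inter> S) \<le> card S"
      using finS by (intro card_mono) auto
  qed
  show "mono (forrester_root k ?n0)"
    by (auto simp: mono_def forrester_root_def intro!: add_mono diff_le_mono)
  show "forrester_root k ?n0 (card J - 1) \<le> M"
    if J: "J \<subseteq> I" "J \<noteq> {}" and le: "(\<Sum>(i, j)\<in>off_diag J. forrester_exponent k S i j) \<le> card J * M" for J M
  proof (rule forrester_root_lower_bound[where s = "card (J \<inter> S)" and m = "card S"])
    have "finite J" using J(1) I(1) finite_subset by blast
    then show "0 < card J" "k * (card J * (card J - 1)) + card (J \<inter> S) * (card (J \<inter> S) - 1) \<le> card J * M"
      using J(2) le by (simp_all add: sum_off_diag_forrester_exponent card_gt_0_iff)
  qed (use bounds[OF J(1)] cases in auto)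
  show "h \<le> forrester_root k ?n0 (card J)"
    if J: "J \<subset> I" and le: "card (I - J) * h + (\<Sum>(i, j)\<in>off_diag J. forrester_exponent k S i j)
      \<le> (\<Sum>j\<in>J. \<Sum>i\<in>I - {j}. forrester_exponent k S i j)" for J h
  proof (rule forrester_root_upper_bound[where s = "card (J \<inter> S)" and m = "card S"])
    have J': "finite J" "J \<subseteq> I" using J I(1) finite_subset by blast+
    show "card J < ?n0 + card S"
      using psubset_card_mono[OF I(1) J] cardI by simp
    show "(?n0 + card S - card J) * h + (k * (card J * (card J - 1)) + card (J \<inter> S) * (card (J \<inter> S) - 1))
        \<le> k * (card J * (?n0 + card S - 1)) + card (J \<inter> S) * (card S - 1)"
      using le unfolding sum_off_diag_forrester_exponent[OF J'(1)] sum_forrester_exponent[OF I(1) J'(2) I(2)]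
        card_Diff_subset[OF J'] cardI .
  qed (use bounds[of J] J cases in auto)
qed

section \<open>The value at a = b = 0\<close>

lemma off_diag_insert:
  assumes "finite I" and "u \<notin> I"
  shows "(\<Prod>(i, j)\<in>off_diag (insert u I). f i j) = (\<Prod>l\<in>I. f l u * f u l) * (\<Prod>(i, j)\<in>off_diag I. f i j)"
proof -
  have "(\<Prod>i\<in>insert u I - {u}. f i u) = (\<Prod>i\<in>I. f i u)"
    using assms by (simp add: Diff_insert_absorb)
  moreover have "(\<Prod>i\<in>insert u I - {j}. f i j) = f u j * (\<Prod>i\<in>I - {j}. f i j)" if "j \<in> I" for j
  proof -
    have "insert u I - {j} = insert u (I - {j})" using that assms by auto
    then show ?thesis using assms by simp
  qed
  ultimately show ?thesis
    using assms by (simp add: prod_off_diag prod.distrib mult_ac)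
qed

text \<open>
  A variable \<open>u\<close> that meets all others with the same exponent acts as the base variable for them.
\<close>

lemma ratio_product_insert:
  assumes "finite I" and "u \<notin> I" and "\<And>i. i \<in> I \<Longrightarrow> \<kappa> i u = c \<and> \<kappa> u i = c"
  shows "(\<Prod>(i, j)\<in>off_diag (insert u I). (1 - X_ratio i j) ^ \<kappa> i j) = morris_product u I c c \<kappa>"
  unfolding off_diag_insert[OF assms(1,2)] morris_product_def endpoint_factor_def
  using assms(3) by simp

definition ratio_constant :: "nat set \<Rightarrow> (nat \<Rightarrow> nat \<Rightarrow> nat) \<Rightarrow> rat"
  where "ratio_constant I \<kappa> = CT (\<Prod>(i, j)\<in>off_diag I. (1 - X_ratio i j) ^ \<kappa> i j)"

text \<open>
  Adding a variable outside the block prepends a zero to the list of the \<open>P\<^sub>l\<close> and shifts the others by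
  \<open>k\<close>. The factors supplied by \<open>CT_morris_product\<close> with \<open>a = b = k\<close> shift the arguments of the
  factorials in the same way, so the shape of the formula is preserved.
\<close>

lemma ratio_constant_insert:
  assumes I: "finite I" "S \<subseteq> I" "u \<notin> I" and cases: "card (I - S) \<le> 1 \<or> card S \<le> 2"
    and IH: "ratio_constant I (forrester_exponent k S) = fact (card S) *
      (\<Prod>l<card I. fact (k + forrester_root k (card (I - S)) l) / (fact k * fact (forrester_root k (card (I - S)) l)))"
  shows "ratio_constant (insert u I) (forrester_exponent k S) = fact (card S) *
      (\<Prod>l<card (insert u I). fact (k + forrester_root k (card (insert u I - S)) l) /
        (fact k * fact (forrester_root k (card (insert u I - S)) l)))"
proof -
  let ?P = "forrester_root k (card (I - S))"
  have "insert u I - S = insert u (I - S)" using I by auto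
  then have card: "card (insert u I - S) = Suc (card (I - S))"
    using I by simp
  have root_Suc: "forrester_root k (card (insert u I - S)) (Suc l) = k + ?P l" for l
    by (simp add: forrester_root_def card)
  have root_0: "forrester_root k (card (insert u I - S)) 0 = 0"
    by (simp add: forrester_root_def)
  have "ratio_constant (insert u I) (forrester_exponent k S) = CT (morris_product u I k k (forrester_exponent k S))"
    unfolding ratio_constant_def using I by (subst ratio_product_insert[where c = k]) (auto simp: forrester_exponent_def)
  also have "\<dots> = ratio_constant I (forrester_exponent k S) *
      (\<Prod>l<card I. (fact (k + k + ?P l) * fact (?P l)) / (fact (k + ?P l) * fact (k + ?P l)))"
    unfolding ratio_constant_def by (rule CT_morris_product[OF I(1,3) root_profile_forrester[OF I(1,2) cases]])
  also have "\<dots> = fact (card S) * (\<Prod>l<card I. fact (k + (k + ?P l)) / (fact k * fact (k + ?P l)))"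
    unfolding IH mult.assoc prod.distrib[symmetric]
    by (intro arg_cong2[where f = "(*)"] prod.cong refl) (simp add: field_simps)
  also have "\<dots> = fact (card S) * (\<Prod>l<card (insert u I). fact (k + forrester_root k (card (insert u I - S)) l) /
        (fact k * fact (forrester_root k (card (insert u I - S)) l)))"
    using I by (simp add: prod.lessThan_Suc_shift root_Suc root_0 del: prod.lessThan_Suc)
  finally show ?thesis .
qed

lemma ratio_constant_const:
  assumes "finite I"
  shows "ratio_constant I (forrester_exponent k {}) = (\<Prod>l<card I. fact (k + k * l) / (fact k * fact (k * l)))"
proof -
  have "ratio_constant I (forrester_exponent k {}) = fact (card ({} :: nat set)) *
      (\<Prod>l<card I. fact (k + forrester_root k (card (I - {})) l) / (fact k * fact (forrester_root k (card (I - {})) l)))"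
    using assms
  proof (induction I rule: finite_induct)
    case empty
    then show ?case by (simp add: ratio_constant_def off_diag_def CT_def)
  next
    case (insert u I)
    then show ?case by (intro ratio_constant_insert) auto
  qed
  then show ?thesis
    by (simp add: forrester_root_def)
qed

text \<open>
  The induction removes the variables outside the block one at a time. Once these are gone, the exponent
  is \<open>k + 1\<close> throughout, the situation of \<open>ratio_constant_const\<close>.
\<close>

lemma ratio_constant_forrester:
  assumes "finite T" and "finite S" and "T \<inter> S = {}" and "card T \<le> 1 \<or> card S \<le> 2"
  shows "ratio_constant (T \<union> S) (forrester_exponent k S) = fact (card S) *
    (\<Prod>l<card (T \<union> S). fact (k + forrester_root k (card T) l) / (fact k * fact (forrester_root k (card T) l)))"
  using assms
proof (induction T rule: finite_induct)
  case empty
  have "ratio_constant S (forrester_exponent k S) = ratio_constant S (forrester_exponent (k + 1) {})"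
    unfolding ratio_constant_def
    by (intro arg_cong[where f = CT] prod.cong) (auto simp: off_diag_def forrester_exponent_def)
  also have "\<dots> = (\<Prod>l<card S. of_nat (l + 1) * (fact (k + (k + 1) * l) / (fact k * fact ((k + 1) * l))))"
    unfolding ratio_constant_const[OF empty.prems(1)]
  proof (rule prod.cong[OF refl])
    fix l
    have "fact (k + 1 + (k + 1) * l) = of_nat ((k + 1) * (l + 1)) * (fact (k + (k + 1) * l) :: rat)"
      using fact_Suc[of "k + (k + 1) * l", where ?'a = rat] by (simp add: algebra_simps)
    moreover have "fact (k + 1) = of_nat (k + 1) * (fact k :: rat)"
      using fact_Suc[of k, where ?'a = rat] by simp
    ultimately show "fact (k + 1 + (k + 1) * l) / (fact (k + 1) * fact ((k + 1) * l))
        = of_nat (l + 1) * (fact (k + (k + 1) * l) / (fact k * fact ((k + 1) * l)) :: rat)"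
      by (simp only: of_nat_mult mult.assoc) (simp del: fact_Suc)
  qed
  also have "\<dots> = fact (card S) * (\<Prod>l<card S. fact (k + (k + 1) * l) / (fact k * fact ((k + 1) * l)))"
  proof -
    have "(\<Prod>l<card S. of_nat (l + 1)) = (fact (card S) :: rat)"
      by (simp add: fact_prod_Suc lessThan_atLeast0)
    then show ?thesis by (simp only: prod.distrib)
  qed
  finally show ?case
    by (simp add: forrester_root_def add_mult_distrib add_ac)
next
  case (insert u T)
  have "ratio_constant (insert u (T \<union> S)) (forrester_exponent k S) = fact (card S) *
      (\<Prod>l<card (insert u (T \<union> S)). fact (k + forrester_root k (card (insert u (T \<union> S) - S)) l) /
        (fact k * fact (forrester_root k (card (insert u (T \<union> S) - S)) l)))"
  proof (rule ratio_constant_insert)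
    have TS: "T \<union> S - S = T" using insert by auto
    have T: "card T \<le> 1 \<or> card S \<le> 2" using insert by auto
    then show "card (T \<union> S - S) \<le> 1 \<or> card S \<le> 2" by (simp add: TS)
    show "ratio_constant (T \<union> S) (forrester_exponent k S) = fact (card S) *
      (\<Prod>l<card (T \<union> S). fact (k + forrester_root k (card (T \<union> S - S)) l) /
        (fact k * fact (forrester_root k (card (T \<union> S - S)) l)))"
      unfolding TS by (rule insert.IH) (use insert T in auto)
  qed (use insert in auto)
  moreover have "insert u (T \<union> S) - S = insert u T" using insert by auto
  ultimately show ?case by simp
qed

section \<open>Forrester's constant term identity\<close>

lemma prod_lessThan_add:
  fixes f :: "nat \<Rightarrow> 'a :: comm_monoid_mult"
  shows "(\<Prod>l<m + n. f l) = (\<Prod>l<m. f l) * (\<Prod>j<n. f (m + j))"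
  by (induction n) (simp_all add: mult_ac)

lemma morris_product_forrester:
  assumes "finite I" and "S \<subseteq> I"
  shows "morris_product v I a b (forrester_exponent k S) =
    (\<Prod>(i, j)\<in>off_diag S. 1 - X_ratio i j) *
    (\<Prod>l\<in>I. (1 - X_ratio l v) ^ a * (1 - X_ratio v l) ^ b) *
    (\<Prod>(i, j)\<in>off_diag I. (1 - X_ratio i j) ^ k)"
proof -
  have "(\<Prod>(i, j)\<in>off_diag I. (1 - X_ratio i j) ^ of_bool (i \<in> S \<and> j \<in> S))
      = (\<Prod>(i, j)\<in>off_diag S. (1 - X_ratio i j))"
    using finite_off_diag[OF assms(1)] assms(2)
    by (intro prod.mono_neutral_cong_right) (auto simp: off_diag_def of_bool_def split: if_splits)
  then show ?thesis
    by (simp add: morris_product_def endpoint_factor_def forrester_exponent_def power_add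
        prod.distrib case_prod_unfold mult_ac)
qed

text \<open>
  At this generality the two cases are one: a block \<open>S\<close> with at most two elements, or with at most one
  variable outside it. The indices \<open>l < card T\<close> of the roots give \<open>M\<close>, the remaining ones give the second
  product, and \<open>fact (card S)\<close> supplies its factors \<open>j + 1\<close>.
\<close>

theorem forrester_constant_term:
  fixes T S :: "nat set" and a b k :: nat
  assumes "finite T" and "finite S" and "T \<inter> S = {}" and "v \<notin> T \<union> S"
    and "card T \<le> 1 \<or> card S \<le> 2"
  shows "CT (morris_product v (T \<union> S) a b (forrester_exponent k S)) = M (card T) a b k *
    (\<Prod>j<card S. (of_nat (j + 1) * fact ((k + 1) * j + a + b + k * card T) * fact (k * j + k + j + k * card T)) /
      (fact k * fact ((k + 1) * j + a + k * card T) * fact ((k + 1) * j + b + k * card T)))"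
proof -
  let ?P = "forrester_root k (card T)"
  define G where "G p = fact (a + b + p) * fact (k + p) / (fact k * fact (a + p) * fact (b + p) :: rat)" for p
  have T: "T \<union> S - S = T" and card: "card (T \<union> S) = card T + card S"
    using assms by (auto simp: card_Un_disjoint)
  have "root_profile (T \<union> S) (forrester_exponent k S) ?P"
    using root_profile_forrester[of "T \<union> S" S k] assms by (simp add: T)
  then have "CT (morris_product v (T \<union> S) a b (forrester_exponent k S))
    = ratio_constant (T \<union> S) (forrester_exponent k S) *
      (\<Prod>l<card (T \<union> S). (fact (a + b + ?P l) * fact (?P l)) / (fact (a + ?P l) * fact (b + ?P l)))"
    unfolding ratio_constant_def using assms by (intro CT_morris_product) auto
  also have "\<dots> = fact (card S) * (\<Prod>l<card (T \<union> S). G (?P l))"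
    unfolding ratio_constant_forrester[OF assms(1,2,3,5)] mult.assoc prod.distrib[symmetric]
    by (intro arg_cong2[where f = "(*)"] prod.cong refl) (simp add: G_def field_simps)
  also have "\<dots> = (\<Prod>l<card T. G (k * l)) * (\<Prod>j<card S. of_nat (j + 1) * G (k * (card T + j) + j))"
  proof -
    have "(\<Prod>j<card S. of_nat (j + 1)) = (fact (card S) :: rat)"
      by (simp add: fact_prod_Suc lessThan_atLeast0)
    then show ?thesis
      unfolding card prod_lessThan_add by (simp add: forrester_root_def prod.distrib)
  qed
  also have "(\<Prod>l<card T. G (k * l)) = M (card T) a b k"
    unfolding M_def G_def by (intro prod.cong refl) (simp add: field_simps)
  also have "(\<Prod>j<card S. of_nat (j + 1) * G (k * (card T + j) + j)) =
    (\<Prod>j<card S. (of_nat (j + 1) * fact ((k + 1) * j + a + b + k * card T) * fact (k * j + k + j + k * card T)) /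
      (fact k * fact ((k + 1) * j + a + k * card T) * fact ((k + 1) * j + b + k * card T)))"
  proof (intro prod.cong refl)
    fix j
    have "a + b + (k * (card T + j) + j) = (k + 1) * j + a + b + k * card T"
      "k + (k * (card T + j) + j) = k * j + k + j + k * card T"
      "a + (k * (card T + j) + j) = (k + 1) * j + a + k * card T"
      "b + (k * (card T + j) + j) = (k + 1) * j + b + k * card T"
      by (simp_all add: algebra_simps)
    then show "of_nat (j + 1) * G (k * (card T + j) + j) =
      (of_nat (j + 1) * fact ((k + 1) * j + a + b + k * card T) * fact (k * j + k + j + k * card T)) /
      (fact k * fact ((k + 1) * j + a + k * card T) * fact ((k + 1) * j + b + k * card T))"
      unfolding G_def by (simp only: times_divide_eq_right mult.assoc)
  qed
  finally show ?thesis .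
qed

theorem corollary5p4:
  fixes n n0 n1 a b k :: nat
  assumes "n = n0 + n1" and "n \<ge> 1" and "n1 = 2 \<or> n1 = n - 1"
  shows "CT ((\<Prod>(i, j)\<in>off_diag {n0 + 1..n}. 1 - X_ratio i j) *
             (\<Prod>l\<in>{1..n}. (1 - X_ratio l 0) ^ a * (1 - X_ratio 0 l) ^ b) *
             (\<Prod>(i, j)\<in>off_diag {1..n}. (1 - X_ratio i j) ^ k)) =
         M n0 a b k *
         (\<Prod>j<n1. (of_nat (j + 1) * fact ((k + 1) * j + a + b + k * n0) *
                     fact (k * j + k + j + k * n0)) /
                   (fact k * fact ((k + 1) * j + a + k * n0) *
                     fact ((k + 1) * j + b + k * n0)))"
proof -
  have split: "{1..n0} \<union> {n0 + 1..n} = {1..n}"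
    using assms(1) by auto
  have card: "card {1..n0} = n0" "card {n0 + 1..n} = n1"
    using assms(1) by simp_all
  have "n0 \<le> 1 \<or> n1 \<le> 2"
    using assms by auto
  then have "CT (morris_product 0 ({1..n0} \<union> {n0 + 1..n}) a b (forrester_exponent k {n0 + 1..n})) = M n0 a b k *
         (\<Prod>j<n1. (of_nat (j + 1) * fact ((k + 1) * j + a + b + k * n0) *
                     fact (k * j + k + j + k * n0)) /
                   (fact k * fact ((k + 1) * j + a + k * n0) *
                     fact ((k + 1) * j + b + k * n0)))"
    using forrester_constant_term[of "{1..n0}" "{n0 + 1..n}" 0 a b k] unfolding card by simp
  then show ?thesis
    unfolding split by (subst (asm) morris_product_forrester) auto
qed

end
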